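(* Let $H=(V,E)$ be a hypergraph of degree $2$ with $V=\{v_1,\dots,v_n\}$, $E=\{e_1,\dots,e_m\}$, and maps $i_1,i_2\colon V\to E$ with $i_1(v)\ne i_2(v)$, $v\in i_1(v)\cap i_2(v)$. Then for any $\vec{\alpha}\in\{0,1\}^{n}$ and $\vec{\beta}\in\{0,1\}^{m}$: $\mathcal{T}_H,\mathcal{A}_{\vec{\alpha},\vec{\beta}}\models{\boldsymbol q}_H$ iff $f_H(\vec{\alpha},\vec{\beta})=1$.
   Context: A hypergraph is of degree $2$ if every vertex lies in exactly two hyperedges. For each $e\in E$ take a variable $z_e$ and a unary predicate $A_e$; for each $v\in V$ a binary predicate $R_v$. ${\boldsymbol q}_H=\exists\vec{z}\bigwedge_{v\in V}R_v(z_{i_1(v)},z_{i_2(v)})$ is a Boolean CQ and $\mathcal{T}_H$ is the ontology with, for each $e\in E$, the tgd $\forall x\,\big(A_e(x)\to\exists y\,\big[\bigwedge_{v:\,i_1(v)=e}R_v(y,x)\land\bigwedge_{v:\,i_2(v)=e}R_v(x,y)\big]\big)$. For a constant $a$, $\mathcal{A}_{\vec{\alpha},\vec{\beta}}=\{R_{v_i}(a,a)\mid\vec{\alpha}(v_i)=1\}\cup\{A_{e_j}(a)\mid\vec{\beta}(e_j)=1\}$, where $\vec\alpha(v_i)$ is the $i$th component of $\vec\alpha$ and $\vec\beta(e_j)$ the $j$th component of $\vec\beta$. $\mathcal{T}_H,\mathcal{A}\models{\boldsymbol q}_H$ means ${\boldsymbol q}_H$ holds in every model of $\mathcal{T}_H\cup\mathcal{A}$.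 The hypergraph function is $f_H=\bigvee_{X\subseteq E\text{ independent}}\big(\bigwedge_{v\in V\setminus V_X}p_v\land\bigwedge_{e\in X}p_e\big)$, where $X$ is independent if its members are pairwise disjoint and $V_X$ is the set of vertices of hyperedges in $X$; $f_H(\vec\alpha,\vec\beta)$ evaluates it with $p_v:=\vec\alpha(v)$ and $p_e:=\vec\beta(e)$. *)

theory Defs
  imports "HOL-Library.FuncSet" "HOL-Library.Infinite_Typeclass"
begin

datatype ('u, 'b, 't) atom = Unary 'u 't | Binary 'b 't 't

record ('d, 'c, 'u, 'b) fo_structure =
  universe :: "'d set"
  const_of :: "'c \<Rightarrow> 'd"
  unary_of :: "'u \<Rightarrow> 'd set"
  binary_of :: "'b \<Rightarrow> ('d \<times> 'd) set"

definition wf_structure :: "('d, 'c, 'u, 'b) fo_structure \<Rightarrow> bool" where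
  "wf_structure I \<longleftrightarrow>
     universe I \<noteq> {} \<and>
     (\<forall>c. const_of I c \<in> universe I) \<and>
     (\<forall>P. unary_of I P \<subseteq> universe I) \<and>
     (\<forall>P. binary_of I P \<subseteq> universe I \<times> universe I)"

fun sat_atom :: "('d, 'c, 'u, 'b) fo_structure \<Rightarrow> ('t \<Rightarrow> 'd) \<Rightarrow> ('u, 'b, 't) atom \<Rightarrow> bool" where
  "sat_atom I h (Unary P t) \<longleftrightarrow> h t \<in> unary_of I P"
| "sat_atom I h (Binary P s t) \<longleftrightarrow> (h s, h t) \<in> binary_of I P"

record ('u, 'b, 'x) boolean_cq =
  cq_vars :: "'x set"
  cq_atoms :: "('u, 'b, 'x) atom set"

definition sat_cq :: "('d, 'c, 'u, 'b) fo_structure \<Rightarrow> ('u, 'b, 'x) boolean_cq \<Rightarrow> bool" where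
  "sat_cq I q \<longleftrightarrow>
     (\<exists>h. (\<forall>z\<in>cq_vars q. h z \<in> universe I) \<and> (\<forall>\<phi>\<in>cq_atoms q. sat_atom I h \<phi>))"

record ('u, 'b, 'x) tgd =
  univ_vars :: "'x set"
  body :: "('u, 'b, 'x) atom set"
  ex_vars :: "'x set"
  head :: "('u, 'b, 'x) atom set"

definition sat_tgd :: "('d, 'c, 'u, 'b) fo_structure \<Rightarrow> ('u, 'b, 'x) tgd \<Rightarrow> bool" where
  "sat_tgd I \<tau> \<longleftrightarrow>
     (\<forall>h. (\<forall>x\<in>univ_vars \<tau>. h x \<in> universe I) \<and> (\<forall>\<phi>\<in>body \<tau>. sat_atom I h \<phi>) \<longrightarrow>
       (\<exists>h'. (\<forall>x\<in>univ_vars \<tau>. h' x = h x) \<and> (\<forall>y\<in>ex_vars \<tau>. h' y \<in> universe I) \<and>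
         (\<forall>\<phi>\<in>head \<tau>. sat_atom I h' \<phi>)))"

definition is_model ::
    "('d, 'c, 'u, 'b) fo_structure \<Rightarrow> ('u, 'b, 'x) tgd set \<Rightarrow> ('u, 'b, 'c) atom set \<Rightarrow> bool" where
  "is_model I T A \<longleftrightarrow>
     wf_structure I \<and> (\<forall>\<tau>\<in>T. sat_tgd I \<tau>) \<and> (\<forall>\<phi>\<in>A. sat_atom I (const_of I) \<phi>)"

text \<open>
  HOL cannot quantify over types inside a formula, so the universes of the models are the
  nonempty subsets of a type \<open>'d\<close>, given as a parameter. Results about entailment are
  polymorphic in \<open>'d\<close>, hence cover models of every cardinality. The type has to be infinite,
  since a finite one would exclude all but the small models.
\<close>

definition entails ::
    "'d::infinite itself \<Rightarrow> ('u, 'b, 'x) tgd set \<Rightarrow> ('u, 'b, 'c) atom set \<Rightarrow>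
     ('u, 'b, 'z) boolean_cq \<Rightarrow> bool" where
  "entails _ T A q \<longleftrightarrow>
     (\<forall>I :: ('d, 'c, 'u, 'b) fo_structure. is_model I T A \<longrightarrow> sat_cq I q)"

definition hypergraph :: "'v set \<Rightarrow> 'v set set \<Rightarrow> bool" where
  "hypergraph V E \<longleftrightarrow> finite V \<and> E \<subseteq> Pow V"

definition degree_2 :: "'v set \<Rightarrow> 'v set set \<Rightarrow> bool" where
  "degree_2 V E \<longleftrightarrow> (\<forall>v\<in>V. card {e \<in> E. v \<in> e} = 2)"

definition independent_edges :: "'v set set \<Rightarrow> bool" where
  "independent_edges X \<longleftrightarrow> pairwise disjnt X"

definition hypergraph_function ::
    "'v set \<Rightarrow> 'v set set \<Rightarrow> ('v \<Rightarrow> bool) \<Rightarrow> ('v set \<Rightarrow> bool) \<Rightarrow> bool" where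
  "hypergraph_function V E p\<^sub>V p\<^sub>E \<longleftrightarrow>
     (\<exists>X\<subseteq>E. independent_edges X \<and> (\<forall>v\<in>V - \<Union>X. p\<^sub>V v) \<and> (\<forall>e\<in>X. p\<^sub>E e))"

text \<open>
  The predicates $A_e$ and $R_v$ are \<open>Unary e\<close> and \<open>Binary v\<close>, and the query variable
  $z_e$ is the hyperedge \<open>e\<close> itself.
\<close>

definition query_of ::
    "'v set \<Rightarrow> 'v set set \<Rightarrow> ('v \<Rightarrow> 'v set) \<Rightarrow> ('v \<Rightarrow> 'v set) \<Rightarrow>
     ('v set, 'v, 'v set) boolean_cq" where
  "query_of V E i\<^sub>1 i\<^sub>2 = \<lparr>cq_vars = E, cq_atoms = {Binary v (i\<^sub>1 v) (i\<^sub>2 v) | v. v \<in> V}\<rparr>"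

datatype tgd_var = VarX | VarY

definition tgd_of ::
    "'v set \<Rightarrow> ('v \<Rightarrow> 'v set) \<Rightarrow> ('v \<Rightarrow> 'v set) \<Rightarrow> 'v set \<Rightarrow> ('v set, 'v, tgd_var) tgd" where
  "tgd_of V i\<^sub>1 i\<^sub>2 e =
     \<lparr>univ_vars = {VarX},
      body = {Unary e VarX},
      ex_vars = {VarY},
      head = {Binary v VarY VarX | v. v \<in> V \<and> i\<^sub>1 v = e} \<union>
             {Binary v VarX VarY | v. v \<in> V \<and> i\<^sub>2 v = e}\<rparr>"

definition ontology_of ::
    "'v set \<Rightarrow> 'v set set \<Rightarrow> ('v \<Rightarrow> 'v set) \<Rightarrow> ('v \<Rightarrow> 'v set) \<Rightarrow>
     ('v set, 'v, tgd_var) tgd set" where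
  "ontology_of V E i\<^sub>1 i\<^sub>2 = tgd_of V i\<^sub>1 i\<^sub>2 ` E"

text \<open>
  The component of the 0/1-vector \<open>bs\<close> at the position where the enumeration \<open>xs\<close> lists
  \<open>x\<close>; meaningful for distinct \<open>xs\<close> containing \<open>x\<close> and \<open>bs\<close> of the same length.
\<close>

definition component :: "'a list \<Rightarrow> bool list \<Rightarrow> 'a \<Rightarrow> bool" where
  "component xs bs x = the (map_of (zip xs bs) x)"

definition abox_of ::
    "'v set \<Rightarrow> 'v set set \<Rightarrow> 'c \<Rightarrow> ('v \<Rightarrow> bool) \<Rightarrow> ('v set \<Rightarrow> bool) \<Rightarrow> ('v set, 'v, 'c) atom set" where
  "abox_of V E a p\<^sub>V p\<^sub>E =
     {Binary v a a | v. v \<in> V \<and> p\<^sub>V v} \<union> {Unary e a | e. e \<in> E \<and> p\<^sub>E e}"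

end

theory Submission imports Defs begin

text \<open>
  An independent set \<open>X\<close> yields a match of the query in any model: send \<open>z\<^sub>e\<close> to the witness
  supplied by the tgd of \<open>e\<close> if \<open>e \<in> X\<close>, and to \<open>a\<close> otherwise; since the two hyperedges of a
  vertex are never both in \<open>X\<close>, every query atom has an endpoint at \<open>a\<close>. Conversely, in the
  canonical model (the constant \<open>a\<close> plus one fresh witness \<open>w\<^sub>e\<close> for each \<open>A\<^sub>e(a)\<close> in the data)
  the hyperedges \<open>e\<close> with \<open>z\<^sub>e\<close> matched to \<open>w\<^sub>e\<close> form an independent set, because \<open>R\<^sub>v\<close> never
  relates two fresh witnesses.
\<close>

text \<open>\<open>i\<close> and \<open>j\<close> already exhaust the two-element set of hyperedges
  through \<open>v\<close>. It is applied with \<open>i\<^sub>1 v\<close> and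
  \<open>i\<^sub>2 v\<close>, which thereby become the only hyperedges containing
  \<open>v\<close>.\<close>

lemma degree_2_edge_cases:
  assumes "degree_2 V E" "v \<in> V" "i \<in> E" "j \<in> E" "i \<noteq> j" "v \<in> i" "v \<in> j"
    and "e \<in> E" "v \<in> e"
  shows "e = i \<or> e = j"
proof -
  have c: "card {e \<in> E. v \<in> e} = 2"
    using assms by (simp add: degree_2_def)
  \<comment> \<open>An infinite set has \<open>card\<close> 0, so cardinality 2 forces
    finiteness.\<close>
  then have "finite {e \<in> E. v \<in> e}"
    by (metis card.infinite zero_neq_numeral)
  moreover have "{i, j} \<subseteq> {e \<in> E. v \<in> e}" "card {i, j} = 2"
    using assms by auto
  ultimately have "{i, j} = {e \<in> E. v \<in> e}"
    using c by (metis card_subset_eq)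
  then show ?thesis
    using assms by blast
qed

text \<open>Places the finite canonical model inside whichever infinite type the models range
  over.\<close>

lemma finite_inj_on_infinite_type:
  assumes "finite A"
  obtains f :: "'a \<Rightarrow> 'd::infinite" where "inj_on f A"
proof -
  obtain B :: "'d set" where "finite B" "card B = card A"
    using infinite_arbitrarily_large[OF infinite_UNIV] by blast
  then obtain f where "bij_betw f A B"
    using finite_same_card_bij[OF assms] by metis
  then show thesis
    using that by (auto simp: bij_betw_def)
qed

text \<open>An assignment matters only through its values at \<open>VarX\<close> and
  \<open>VarY\<close>, so quantifying over assignments amounts to quantifying over two
  elements.\<close>

lemma sat_tgd_tgd_of_iff:
  "sat_tgd I (tgd_of V i\<^sub>1 i\<^sub>2 e) \<longleftrightarrow>
     (\<forall>x \<in> universe I \<inter> unary_of I e. \<exists>y \<in> universe I.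
       (\<forall>v\<in>V. i\<^sub>1 v = e \<longrightarrow> (y, x) \<in> binary_of I v) \<and>
       (\<forall>v\<in>V. i\<^sub>2 v = e \<longrightarrow> (x, y) \<in> binary_of I v))"
  (is "?L \<longleftrightarrow> ?R")
proof
  assume L: ?L
  show ?R
  proof
    fix x assume x: "x \<in> universe I \<inter> unary_of I e"
    \<comment> \<open>The tgd is applied to the constant assignment with value
      \<open>x\<close>.\<close>
    obtain h' where h': "h' VarX = x" "h' VarY \<in> universe I"
      "\<forall>\<phi>\<in>head (tgd_of V i\<^sub>1 i\<^sub>2 e). sat_atom I h' \<phi>"
      using L[unfolded sat_tgd_def, rule_format, of "\<lambda>_. x"] x by (auto simp: tgd_of_def)
    have "sat_atom I h' (Binary v VarY VarX)" if "v \<in> V" "i\<^sub>1 v = e" for v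
      by (rule bspec[OF h'(3)]) (use that in \<open>auto simp: tgd_of_def\<close>)
    moreover have "sat_atom I h' (Binary v VarX VarY)" if "v \<in> V" "i\<^sub>2 v = e" for v
      by (rule bspec[OF h'(3)]) (use that in \<open>auto simp: tgd_of_def\<close>)
    ultimately show "\<exists>y \<in> universe I.
       (\<forall>v\<in>V. i\<^sub>1 v = e \<longrightarrow> (y, x) \<in> binary_of I v) \<and>
       (\<forall>v\<in>V. i\<^sub>2 v = e \<longrightarrow> (x, y) \<in> binary_of I v)"
      using h' by auto
  qed
next
  assume R: ?R
  show ?L
    unfolding sat_tgd_def
  proof (intro allI impI)
    fix h assume h: "(\<forall>x\<in>univ_vars (tgd_of V i\<^sub>1 i\<^sub>2 e). h x \<in> universe I) \<and>
      (\<forall>\<phi>\<in>body (tgd_of V i\<^sub>1 i\<^sub>2 e). sat_atom I h \<phi>)"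
    then have "h VarX \<in> universe I \<inter> unary_of I e"
      by (simp add: tgd_of_def)
    then obtain y where "y \<in> universe I"
      "\<forall>v\<in>V. i\<^sub>1 v = e \<longrightarrow> (y, h VarX) \<in> binary_of I v"
      "\<forall>v\<in>V. i\<^sub>2 v = e \<longrightarrow> (h VarX, y) \<in> binary_of I v"
      using R by blast
    then show "\<exists>h'. (\<forall>x\<in>univ_vars (tgd_of V i\<^sub>1 i\<^sub>2 e). h' x = h x) \<and>
        (\<forall>y\<in>ex_vars (tgd_of V i\<^sub>1 i\<^sub>2 e). h' y \<in> universe I) \<and>
        (\<forall>\<phi>\<in>head (tgd_of V i\<^sub>1 i\<^sub>2 e). sat_atom I h' \<phi>)"
      by (intro exI[of _ "h(VarY := y)"]) (auto simp: tgd_of_def)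
  qed
qed

lemma sat_cq_query_of_iff:
  "sat_cq I (query_of V E i\<^sub>1 i\<^sub>2) \<longleftrightarrow>
     (\<exists>h. (\<forall>e\<in>E. h e \<in> universe I) \<and> (\<forall>v\<in>V. (h (i\<^sub>1 v), h (i\<^sub>2 v)) \<in> binary_of I v))"
  unfolding sat_cq_def query_of_def by (intro ex_cong1) auto

lemma sat_abox_of_iff:
  "(\<forall>\<phi>\<in>abox_of V E a p\<^sub>V p\<^sub>E. sat_atom I h \<phi>) \<longleftrightarrow>
     (\<forall>v\<in>V. p\<^sub>V v \<longrightarrow> (h a, h a) \<in> binary_of I v) \<and> (\<forall>e\<in>E. p\<^sub>E e \<longrightarrow> h a \<in> unary_of I e)"
  unfolding abox_of_def ball_Un by (intro conj_cong) auto

lemma entails_query_if_hypergraph_function: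
  fixes V :: "'v set" and a :: 'c
  assumes deg: "degree_2 V E"
    and i: "i\<^sub>1 \<in> V \<rightarrow> E" "i\<^sub>2 \<in> V \<rightarrow> E"
    and neq: "\<And>v. v \<in> V \<Longrightarrow> i\<^sub>1 v \<noteq> i\<^sub>2 v"
    and inc: "\<And>v. v \<in> V \<Longrightarrow> v \<in> i\<^sub>1 v \<inter> i\<^sub>2 v"
    and f: "hypergraph_function V E p\<^sub>V p\<^sub>E"
  shows "entails TYPE('d::infinite) (ontology_of V E i\<^sub>1 i\<^sub>2)
           (abox_of V E a p\<^sub>V p\<^sub>E) (query_of V E i\<^sub>1 i\<^sub>2)"
  unfolding entails_def
proof (intro allI impI)
  fix I :: "('d, 'c, 'v set, 'v) fo_structure"
  assume M: "is_model I (ontology_of V E i\<^sub>1 i\<^sub>2) (abox_of V E a p\<^sub>V p\<^sub>E)"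
  define d where "d = const_of I a"
  have d: "d \<in> universe I"
    using M by (simp add: d_def is_model_def wf_structure_def)
  have facts: "\<And>v. v \<in> V \<Longrightarrow> p\<^sub>V v \<Longrightarrow> (d, d) \<in> binary_of I v"
    "\<And>e. e \<in> E \<Longrightarrow> p\<^sub>E e \<Longrightarrow> d \<in> unary_of I e"
    using M by (auto simp: is_model_def sat_abox_of_iff d_def)
  obtain X where X: "X \<subseteq> E" "independent_edges X" "\<And>v. v \<in> V - \<Union>X \<Longrightarrow> p\<^sub>V v"
    "\<And>e. e \<in> X \<Longrightarrow> p\<^sub>E e"
    using f by (auto simp: hypergraph_function_def)
  have "\<forall>e\<in>X. \<exists>y \<in> universe I. (\<forall>v\<in>V. i\<^sub>1 v = e \<longrightarrow> (y, d) \<in> binary_of I v) \<and>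
       (\<forall>v\<in>V. i\<^sub>2 v = e \<longrightarrow> (d, y) \<in> binary_of I v)"
  proof
    fix e assume "e \<in> X"
    then have "e \<in> E" "d \<in> universe I \<inter> unary_of I e"
      using X facts d by auto
    moreover have "sat_tgd I (tgd_of V i\<^sub>1 i\<^sub>2 e)"
      using M \<open>e \<in> E\<close> by (simp add: is_model_def ontology_of_def)
    ultimately show "\<exists>y \<in> universe I. (\<forall>v\<in>V. i\<^sub>1 v = e \<longrightarrow> (y, d) \<in> binary_of I v) \<and>
       (\<forall>v\<in>V. i\<^sub>2 v = e \<longrightarrow> (d, y) \<in> binary_of I v)"
      unfolding sat_tgd_tgd_of_iff by blast
  qed
  \<comment> \<open>Choice of one witness per hyperedge of \<open>X\<close>; the last two facts
    specialise \<open>e\<close> to \<open>i\<^sub>1 v\<close> and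
    \<open>i\<^sub>2 v\<close>.\<close>
  then obtain w where w: "\<And>e. e \<in> X \<Longrightarrow> w e \<in> universe I"
    "\<And>v. v \<in> V \<Longrightarrow> i\<^sub>1 v \<in> X \<Longrightarrow> (w (i\<^sub>1 v), d) \<in> binary_of I v"
    "\<And>v. v \<in> V \<Longrightarrow> i\<^sub>2 v \<in> X \<Longrightarrow> (d, w (i\<^sub>2 v)) \<in> binary_of I v"
    by metis
  define h where "h e = (if e \<in> X then w e else d)" for e
  have "(h (i\<^sub>1 v), h (i\<^sub>2 v)) \<in> binary_of I v" if v: "v \<in> V" for v
  proof -
    have notboth: "\<not> (i\<^sub>1 v \<in> X \<and> i\<^sub>2 v \<in> X)"
      using X(2) neq[OF v] inc[OF v]
      by (auto simp: independent_edges_def pairwise_def disjnt_def)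
    \<comment> \<open>No other hyperedge contains \<open>v\<close>, so \<open>X\<close> leaves
      \<open>v\<close> uncovered and the data contain the loop at \<open>a\<close>.\<close>
    have "p\<^sub>V v" if "i\<^sub>1 v \<notin> X" "i\<^sub>2 v \<notin> X"
    proof -
      have "e = i\<^sub>1 v \<or> e = i\<^sub>2 v" if "e \<in> E" "v \<in> e" for e
        using degree_2_edge_cases[OF deg v _ _ neq[OF v]] i v inc[OF v] that by blast
      then have "v \<notin> \<Union>X"
        using that X(1) by blast
      then show ?thesis
        using X(3) v by blast
    qed
    then show ?thesis
      using notboth w(2,3)[OF v] facts(1)[OF v] by (auto simp: h_def)
  qed
  then show "sat_cq I (query_of V E i\<^sub>1 i\<^sub>2)"
    unfolding sat_cq_query_of_iff using w(1) d by (intro exI[of _ h]) (auto simp: h_def)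
qed

lemma hypergraph_function_if_entails_query:
  fixes V :: "'v set" and a :: 'c
  assumes fin: "finite E"
    and deg: "degree_2 V E" and sub: "E \<subseteq> Pow V"
    and i: "i\<^sub>1 \<in> V \<rightarrow> E" "i\<^sub>2 \<in> V \<rightarrow> E"
    and neq: "\<And>v. v \<in> V \<Longrightarrow> i\<^sub>1 v \<noteq> i\<^sub>2 v"
    and inc: "\<And>v. v \<in> V \<Longrightarrow> v \<in> i\<^sub>1 v \<inter> i\<^sub>2 v"
    and ent: "entails TYPE('d::infinite) (ontology_of V E i\<^sub>1 i\<^sub>2)
           (abox_of V E a p\<^sub>V p\<^sub>E) (query_of V E i\<^sub>1 i\<^sub>2)"
  shows "hypergraph_function V E p\<^sub>V p\<^sub>E"
proof -
  \<comment> \<open>\<open>None\<close> names the constant and \<open>Some e\<close> the witness for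
    \<open>e\<close>; injectivity keeps the witnesses apart from \<open>d\<close>.\<close>
  obtain f :: "'v set option \<Rightarrow> 'd" where f: "inj_on f (insert None (Some ` E))"
    using finite_inj_on_infinite_type fin by (metis finite_imageI finite_insert)
  define d where "d = f None"
  define w where "w = (\<lambda>e. f (Some e))"
  have wd: "w e \<noteq> d" if "e \<in> E" for e
    using f that by (auto simp: inj_on_def w_def d_def)
  \<comment> \<open>The universe has a \<open>w e\<close> for every \<open>e\<close> in
    \<open>E\<close>, but a relation involves it as a witness only if \<open>p\<^sub>E e\<close>
    holds. Unary predicates hold at most at \<open>d\<close>, so the tgds fire nowhere else.\<close>
  define I :: "('d, 'c, 'v set, 'v) fo_structure" where
    "I = \<lparr>universe = insert d (w ` E), const_of = (\<lambda>_. d),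
          unary_of = (\<lambda>e. {x. x = d \<and> e \<in> E \<and> p\<^sub>E e}),
          binary_of = (\<lambda>v. {(x, y). v \<in> V \<and> (x = d \<and> y = d \<and> p\<^sub>V v \<or>
             x = w (i\<^sub>1 v) \<and> y = d \<and> p\<^sub>E (i\<^sub>1 v) \<or> x = d \<and> y = w (i\<^sub>2 v) \<and> p\<^sub>E (i\<^sub>2 v))})\<rparr>"
  have "wf_structure I"
    using i by (auto simp: wf_structure_def I_def)
  moreover have "sat_tgd I (tgd_of V i\<^sub>1 i\<^sub>2 e)" if "e \<in> E" for e
    unfolding sat_tgd_tgd_of_iff
    by (intro ballI bexI[of _ "w e"]) (use that in \<open>auto simp: I_def\<close>)
  moreover have "\<forall>\<phi>\<in>abox_of V E a p\<^sub>V p\<^sub>E. sat_atom I (const_of I) \<phi>"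
    unfolding sat_abox_of_iff by (simp add: I_def)
  ultimately have "is_model I (ontology_of V E i\<^sub>1 i\<^sub>2) (abox_of V E a p\<^sub>V p\<^sub>E)"
    by (simp add: is_model_def ontology_of_def)
  then have "sat_cq I (query_of V E i\<^sub>1 i\<^sub>2)"
    using ent by (simp add: entails_def)
  then obtain h where "\<And>v. v \<in> V \<Longrightarrow> (h (i\<^sub>1 v), h (i\<^sub>2 v)) \<in> binary_of I v"
    unfolding sat_cq_query_of_iff by blast
  \<comment> \<open>In each of the three cases at least one endpoint is \<open>d\<close>.\<close>
  then have h: "h (i\<^sub>1 v) = d \<and> h (i\<^sub>2 v) = d \<and> p\<^sub>V v \<or>
      h (i\<^sub>1 v) = w (i\<^sub>1 v) \<and> h (i\<^sub>2 v) = d \<and> p\<^sub>E (i\<^sub>1 v) \<or>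
      h (i\<^sub>1 v) = d \<and> h (i\<^sub>2 v) = w (i\<^sub>2 v) \<and> p\<^sub>E (i\<^sub>2 v)" if "v \<in> V" for v
    using that by (fastforce simp: I_def)
  \<comment> \<open>The conjunct \<open>p\<^sub>E e\<close> matters for an empty hyperedge: its
    variable occurs in no query atom, so \<open>h\<close> may send it to \<open>w e\<close> even
    when \<open>p\<^sub>E e\<close> fails.\<close>
  define X where "X = {e \<in> E. h e = w e \<and> p\<^sub>E e}"
  have "disjnt e e'" if e: "e \<in> X" "e' \<in> X" "e \<noteq> e'" for e e'
  proof (rule ccontr)
    assume "\<not> disjnt e e'"
    then obtain v where v: "v \<in> e" "v \<in> e'"
      by (auto simp: disjnt_def)
    then have "v \<in> V"
      using e sub by (auto simp: X_def)
    have "x = i\<^sub>1 v \<or> x = i\<^sub>2 v" if "x \<in> E" "v \<in> x" for x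
      using degree_2_edge_cases[OF deg \<open>v \<in> V\<close> _ _ neq[OF \<open>v \<in> V\<close>]] i \<open>v \<in> V\<close> inc[OF \<open>v \<in> V\<close>] that
      by blast
    \<comment> \<open>The distinct hyperedges \<open>e\<close> and \<open>e'\<close> through
      \<open>v\<close> must be \<open>i\<^sub>1 v\<close> and \<open>i\<^sub>2 v\<close> in some
      order. Then neither endpoint of the atom for \<open>v\<close> is \<open>d\<close>,
      contradicting \<open>h\<close>.\<close>
    then have "i\<^sub>1 v \<in> X" "i\<^sub>2 v \<in> X"
      using e v by (auto simp: X_def)
    then show False
      using h[OF \<open>v \<in> V\<close>] wd by (auto simp: X_def)
  qed
  then have "independent_edges X"
    by (simp add: independent_edges_def pairwise_def)
  moreover have "p\<^sub>V v" if "v \<in> V - \<Union>X" for v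
  proof -
    \<comment> \<open>The two witness cases of \<open>h\<close> would put \<open>i\<^sub>1 v\<close>
      or \<open>i\<^sub>2 v\<close> into \<open>X\<close>, so only the loop at \<open>d\<close>
      remains, and it comes with \<open>p\<^sub>V v\<close>.\<close>
    have "i\<^sub>1 v \<notin> X" "i\<^sub>2 v \<notin> X" "i\<^sub>1 v \<in> E" "i\<^sub>2 v \<in> E"
      using that inc[of v] i by auto
    then show ?thesis
      using h[of v] that by (auto simp: X_def)
  qed
  ultimately show ?thesis
    unfolding hypergraph_function_def by (intro exI[of _ X]) (auto simp: X_def)
qed

theorem theorem11:
  fixes V :: "'v set" and E :: "'v set set"
    and vs :: "'v list" and es :: "'v set list"
    and i\<^sub>1 i\<^sub>2 :: "'v \<Rightarrow> 'v set"
    and \<alpha> \<beta> :: "bool list"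
    and n m :: nat
    and a :: 'c
  assumes "hypergraph V E" and "degree_2 V E"
    and "set vs = V" and "distinct vs" and "length vs = n"
    and "set es = E" and "distinct es" and "length es = m"
    and "i\<^sub>1 \<in> V \<rightarrow> E" and "i\<^sub>2 \<in> V \<rightarrow> E"
    and "\<And>v. v \<in> V \<Longrightarrow> i\<^sub>1 v \<noteq> i\<^sub>2 v"
    and "\<And>v. v \<in> V \<Longrightarrow> v \<in> i\<^sub>1 v \<inter> i\<^sub>2 v"
    and "length \<alpha> = n" and "length \<beta> = m"
  shows "entails TYPE('d::infinite) (ontology_of V E i\<^sub>1 i\<^sub>2)
           (abox_of V E a (component vs \<alpha>) (component es \<beta>)) (query_of V E i\<^sub>1 i\<^sub>2)
         \<longleftrightarrow> hypergraph_function V E (component vs \<alpha>) (component es \<beta>)"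
proof
  assume "entails TYPE('d) (ontology_of V E i\<^sub>1 i\<^sub>2)
           (abox_of V E a (component vs \<alpha>) (component es \<beta>)) (query_of V E i\<^sub>1 i\<^sub>2)"
  moreover have "finite E" "E \<subseteq> Pow V"
    using assms(1,6) by (auto simp: hypergraph_def)
  ultimately show "hypergraph_function V E (component vs \<alpha>) (component es \<beta>)"
    using hypergraph_function_if_entails_query assms(2,9-12) by metis
next
  assume "hypergraph_function V E (component vs \<alpha>) (component es \<beta>)"
  then show "entails TYPE('d) (ontology_of V E i\<^sub>1 i\<^sub>2)
           (abox_of V E a (component vs \<alpha>) (component es \<beta>)) (query_of V E i\<^sub>1 i\<^sub>2)"
    using entails_query_if_hypergraph_function assms(2,9-12) by metis
qed

end
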